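(* Let $\Delta$ be a simplicial complex of dimension $d\ge 1$. I. If $\Delta$ is vertex-chordal then $\Delta$ is E-chordal; if $\Delta$ is E-chordal then $\Delta$ is ridge-chordal. Both implications are strict: there is an E-chordal complex that is not vertex-chordal, and a ridge-chordal complex that is not E-chordal. II. If $\Delta$ is pure, then $\Delta$ is vertex-chordal if and only if $\Delta$ is E-chordal.
   Context: Simplicial complexes are finite and not necessarily pure. A vertex labeling of a complex with $n$ vertices is a bijection of its vertices with $[n]$; $\max F$ is the largest label in $F$; the size of a face is its number of vertices. $\Delta$ is E-chordal if it has a labeling such that for every two facets $F\ne G$ with the same size and same maximum, every subset $H\subseteq F\cup G$ with $|H|=|F|$ is a face of $\Delta$. A $t$-clique of a complex $\Gamma$ is a set $X$ of vertices such that any $k+1\le t+1$ vertices of $X$ span a $k$-face of $\Gamma$. A face of $\Gamma$ is $t$-simplicial if the vertices of its star in $\Gamma$ form a $t$-clique of $\Gamma$. Deleting above a face $F$ of $\Gamma$ means passing to the complex $\operatorname{abdel}(F,\Gamma)$ whose facets are the facets of $\Gamma$ not containing $F$. The empty set has dimension $-1$. For $0\le j<d$, a $d$-dimensional complex $\Delta$ is $j$-face-chordal if it can be reduced to a complex of dimension $\le j$ by repeatedly deleting above a $j$-face that is $d$-simplicial in the current complex (here $d$ is always the dimension of the original $\Delta$). Vertex-chordal means $0$-face-chordal; ridge-chordal means $(d-1)$-face-chordal. *)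

theory Defs
  imports Main
begin

text \<open>
  Complexes are abstract, given by their set of faces.  The void complex (no faces, hence no
  facets) is admitted alongside the complex whose only face is the empty set, because deleting
  above a face that lies in every facet leaves no facets.
\<close>

definition simplicial_complex :: "'a set set \<Rightarrow> bool" where
  "simplicial_complex \<Delta> \<longleftrightarrow>
     finite \<Delta> \<and> (\<forall>F\<in>\<Delta>. finite F) \<and> (\<forall>F\<in>\<Delta>. \<forall>G. G \<subseteq> F \<longrightarrow> G \<in> \<Delta>)"

definition vertices :: "'a set set \<Rightarrow> 'a set" where
  "vertices \<Delta> = {v. {v} \<in> \<Delta>}"

definition facets :: "'a set set \<Rightarrow> 'a set set" where
  "facets \<Delta> = {F \<in> \<Delta>. \<forall>G\<in>\<Delta>. F \<subseteq> G \<longrightarrow> G = F}"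

definition face_dim :: "'a set \<Rightarrow> int" where
  "face_dim F = int (card F) - 1"

text \<open>The inserted \<open>-1\<close> only matters for the void complex.\<close>

definition complex_dim :: "'a set set \<Rightarrow> int" where
  "complex_dim \<Delta> = Max (insert (-1) (face_dim ` \<Delta>))"

definition pure_complex :: "'a set set \<Rightarrow> bool" where
  "pure_complex \<Delta> \<longleftrightarrow> (\<forall>F\<in>facets \<Delta>. \<forall>G\<in>facets \<Delta>. face_dim F = face_dim G)"

definition vertex_labeling :: "'a set set \<Rightarrow> ('a \<Rightarrow> nat) \<Rightarrow> bool" where
  "vertex_labeling \<Delta> l \<longleftrightarrow> bij_betw l (vertices \<Delta>) {1..card (vertices \<Delta>)}"

text \<open>
  \<open>Max (l ` F)\<close> is never evaluated at an empty \<open>F\<close> in a relevant way: if the empty set is a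
  facet of a complex, it is the only one.
\<close>

definition E_chordal :: "'a set set \<Rightarrow> bool" where
  "E_chordal \<Delta> \<longleftrightarrow>
     (\<exists>l. vertex_labeling \<Delta> l \<and>
        (\<forall>F\<in>facets \<Delta>. \<forall>G\<in>facets \<Delta>.
           F \<noteq> G \<and> card F = card G \<and> Max (l ` F) = Max (l ` G) \<longrightarrow>
           (\<forall>H. H \<subseteq> F \<union> G \<and> card H = card F \<longrightarrow> H \<in> \<Delta>)))"

definition clique :: "int \<Rightarrow> 'a set set \<Rightarrow> 'a set \<Rightarrow> bool" where
  "clique t \<Gamma> X \<longleftrightarrow>
     X \<subseteq> vertices \<Gamma> \<and> (\<forall>Y. Y \<subseteq> X \<and> Y \<noteq> {} \<and> face_dim Y \<le> t \<longrightarrow> Y \<in> \<Gamma>)"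

definition star :: "'a set \<Rightarrow> 'a set set \<Rightarrow> 'a set set" where
  "star F \<Gamma> = {G \<in> \<Gamma>. F \<union> G \<in> \<Gamma>}"

definition simplicial_face :: "int \<Rightarrow> 'a set set \<Rightarrow> 'a set \<Rightarrow> bool" where
  "simplicial_face t \<Gamma> F \<longleftrightarrow> F \<in> \<Gamma> \<and> clique t \<Gamma> (vertices (star F \<Gamma>))"

definition abdel :: "'a set \<Rightarrow> 'a set set \<Rightarrow> 'a set set" where
  "abdel F \<Gamma> = {G. \<exists>H\<in>facets \<Gamma>. \<not> F \<subseteq> H \<and> G \<subseteq> H}"

definition abdel_step :: "int \<Rightarrow> int \<Rightarrow> 'a set set \<Rightarrow> 'a set set \<Rightarrow> bool" where
  "abdel_step d j \<Gamma> \<Gamma>' \<longleftrightarrow>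
     (\<exists>F. face_dim F = j \<and> simplicial_face d \<Gamma> F \<and> \<Gamma>' = abdel F \<Gamma>)"

text \<open>
  The clique parameter stays fixed at the dimension of the original complex throughout the
  reduction.
\<close>

definition face_chordal :: "int \<Rightarrow> 'a set set \<Rightarrow> bool" where
  "face_chordal j \<Delta> \<longleftrightarrow>
     0 \<le> j \<and> j < complex_dim \<Delta> \<and>
     (\<exists>\<Gamma>. (abdel_step (complex_dim \<Delta>) j)\<^sup>*\<^sup>* \<Delta> \<Gamma> \<and> complex_dim \<Gamma> \<le> j)"

definition vertex_chordal :: "'a set set \<Rightarrow> bool" where
  "vertex_chordal \<Delta> \<longleftrightarrow> face_chordal 0 \<Delta>"

definition ridge_chordal :: "'a set set \<Rightarrow> bool" where
  "ridge_chordal \<Delta> \<longleftrightarrow> face_chordal (complex_dim \<Delta> - 1) \<Delta>"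

end

theory Submission
  imports Defs "HOL-Library.Nat_Bijection"
begin

text \<open>
  Call a face top-dimensional if it has \<open>n = d + 1\<close> vertices.  For an E-chordal labeling, all
  \<open>n\<close>-subsets of the union of the top-dimensional faces with maximum \<open>v\<close> are faces.

  A vertex reduction gives a labeling by numbering the deleted vertices downwards: two facets with
  maximum \<open>v\<close> lie in the star of \<open>v\<close> at the moment of its deletion.  Conversely, in a pure
  complex one deletes the vertices from the largest label down.

  For ridges, order the top-dimensional faces by the binary weight \<open>\<Sum>\<^sub>x 2\<^bsup>l x\<^esup>\<close> of what remains
  after dropping the smallest vertex, and let \<open>D\<close> be a largest face still present.  The ridge
  \<open>R = D - {min D}\<close> can be deleted: every surviving face \<open>R \<union> {x}\<close> has \<open>x\<close> below \<open>R\<close>, so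
  each \<open>n\<close>-subset of the star is a face of the original complex of weight at most that of \<open>D\<close>.
  Deleting above \<open>R\<close> removes exactly the faces of largest weight.

  Strictness is witnessed by facets below the top dimension: a hollow triangle attached to a
  triangle blocks vertex deletions, and a 4-cycle next to a triangle violates E-chordality but is
  invisible to ridge deletions.
\<close>

section \<open>Faces, facets, stars and deletion\<close>

lemma face_subset: "simplicial_complex \<Gamma> \<Longrightarrow> F \<in> \<Gamma> \<Longrightarrow> G \<subseteq> F \<Longrightarrow> G \<in> \<Gamma>"
  unfolding simplicial_complex_def by blast

lemma face_finite: "simplicial_complex \<Gamma> \<Longrightarrow> F \<in> \<Gamma> \<Longrightarrow> finite F"
  unfolding simplicial_complex_def by blast

lemma face_subset_vertices: "simplicial_complex \<Gamma> \<Longrightarrow> F \<in> \<Gamma> \<Longrightarrow> F \<subseteq> vertices \<Gamma>"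
  unfolding vertices_def by (auto intro: face_subset)

lemma finite_vertices:
  assumes "simplicial_complex \<Gamma>"
  shows "finite (vertices \<Gamma>)"
proof -
  have "vertices \<Gamma> \<subseteq> \<Union>\<Gamma>"
    unfolding vertices_def by blast
  moreover have "finite (\<Union>\<Gamma>)"
    using assms unfolding simplicial_complex_def by blast
  ultimately show ?thesis
    by (rule finite_subset)
qed

lemma facet_is_face: "F \<in> facets \<Gamma> \<Longrightarrow> F \<in> \<Gamma>"
  unfolding facets_def by blast

lemma facet_maximal: "F \<in> facets \<Gamma> \<Longrightarrow> G \<in> \<Gamma> \<Longrightarrow> F \<subseteq> G \<Longrightarrow> G = F"
  unfolding facets_def by blast

lemma face_in_facet:
  assumes "simplicial_complex \<Gamma>" "F \<in> \<Gamma>"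
  obtains H where "H \<in> facets \<Gamma>" "F \<subseteq> H"
proof -
  have "finite \<Gamma>"
    using assms unfolding simplicial_complex_def by blast
  from finite_has_maximal2[OF this assms(2)]
  obtain H where H: "H \<in> \<Gamma>" "F \<subseteq> H" "\<And>G. G \<in> \<Gamma> \<Longrightarrow> H \<subseteq> G \<Longrightarrow> H = G"
    by metis
  then have "H \<in> facets \<Gamma>"
    unfolding facets_def by auto
  then show ?thesis
    using H(2) that by blast
qed

lemma card_max_imp_facet:
  assumes "simplicial_complex \<Gamma>" "\<forall>F\<in>\<Gamma>. card F \<le> n" "E \<in> \<Gamma>" "card E = n"
  shows "E \<in> facets \<Gamma>"
  unfolding facets_def
proof (intro CollectI conjI ballI impI)
  fix G assume "G \<in> \<Gamma>" "E \<subseteq> G"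
  with assms show "G = E"
    by (metis card_seteq face_finite)
qed fact

lemma complex_dim_le_iff:
  assumes "simplicial_complex \<Gamma>"
  shows "complex_dim \<Gamma> \<le> j \<longleftrightarrow> -1 \<le> j \<and> (\<forall>F\<in>\<Gamma>. face_dim F \<le> j)"
  using assms unfolding complex_dim_def simplicial_complex_def by (subst Max_le_iff) auto

lemma complex_dim_attained:
  assumes "simplicial_complex \<Gamma>" "complex_dim \<Gamma> \<ge> 0"
  obtains F where "F \<in> \<Gamma>" "face_dim F = complex_dim \<Gamma>"
proof -
  have "Max (insert (-1) (face_dim ` \<Gamma>)) \<in> insert (-1) (face_dim ` \<Gamma>)"
    using assms unfolding simplicial_complex_def by (intro Max_in) auto
  with assms(2) that show ?thesis
    unfolding complex_dim_def by auto
qed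

lemma simplicial_complex_abdel:
  assumes "simplicial_complex \<Gamma>"
  shows "simplicial_complex (abdel F \<Gamma>)" and "abdel F \<Gamma> \<subseteq> \<Gamma>"
proof -
  show sub: "abdel F \<Gamma> \<subseteq> \<Gamma>"
    using assms unfolding abdel_def facets_def by (auto intro: face_subset)
  have "finite (abdel F \<Gamma>)"
    using assms finite_subset[OF sub] unfolding simplicial_complex_def by blast
  moreover have "finite G" if "G \<in> abdel F \<Gamma>" for G
    using sub face_finite[OF assms] that by blast
  moreover have "H \<in> abdel F \<Gamma>" if "G \<in> abdel F \<Gamma>" "H \<subseteq> G" for G H
    using that unfolding abdel_def by blast
  ultimately show "simplicial_complex (abdel F \<Gamma>)"
    unfolding simplicial_complex_def by blast
qed

text \<open>The generators of the new complex are facets of the old one, hence pairwise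
  incomparable, so no new facets arise. Both reductions are therefore tracked by filtering sets of
  facets.\<close>

lemma facets_abdel:
  assumes "simplicial_complex \<Gamma>"
  shows "facets (abdel F \<Gamma>) = {H \<in> facets \<Gamma>. \<not> F \<subseteq> H}"
proof (intro equalityI subsetI)
  fix G assume G: "G \<in> facets (abdel F \<Gamma>)"
  then obtain H where H: "H \<in> facets \<Gamma>" "\<not> F \<subseteq> H" "G \<subseteq> H"
    using facet_is_face[OF G] unfolding abdel_def by blast
  then have "H \<in> abdel F \<Gamma>"
    unfolding abdel_def by blast
  from facet_maximal[OF G this H(3)] have "H = G" .
  with H show "G \<in> {H \<in> facets \<Gamma>. \<not> F \<subseteq> H}"
    by blast
next
  fix H assume H: "H \<in> {H \<in> facets \<Gamma>. \<not> F \<subseteq> H}"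
  then have "H \<in> abdel F \<Gamma>"
    unfolding abdel_def by blast
  moreover have "G = H" if "G \<in> abdel F \<Gamma>" "H \<subseteq> G" for G
    using that H simplicial_complex_abdel(2)[OF assms] facet_maximal[of H \<Gamma> G] by blast
  ultimately show "H \<in> facets (abdel F \<Gamma>)"
    unfolding facets_def by blast
qed

lemma vertices_star:
  assumes "simplicial_complex \<Gamma>"
  shows "vertices (star F \<Gamma>) = {x. insert x F \<in> \<Gamma>}"
  unfolding vertices_def star_def using assms by (auto intro: face_subset)

text \<open>A smaller subset of \<open>N\<close> extends to one with exactly \<open>n\<close>
  elements, since \<open>F\<close> guarantees that \<open>N\<close> is large enough. Checking
  subsets of the top size then suffices.\<close>

lemma cliqueI:
  assumes cx: "simplicial_complex \<Gamma>" and n: "n > 0"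
    and N: "finite N" "F \<subseteq> N" "card F = n"
    and all: "\<And>H. H \<subseteq> N \<Longrightarrow> card H = n \<Longrightarrow> H \<in> \<Gamma>"
  shows "clique (int n - 1) \<Gamma> N"
proof -
  have Y: "Y \<in> \<Gamma>" if "Y \<subseteq> N" "card Y \<le> n" for Y
  proof -
    have "n \<le> card N"
      using N card_mono by blast
    from exists_subset_between[OF that(2) this that(1) N(1)]
    obtain H where "Y \<subseteq> H" "H \<subseteq> N" "card H = n"
      by metis
    then show ?thesis
      using face_subset[OF cx all] by metis
  qed
  show ?thesis
    unfolding clique_def
  proof (intro conjI allI impI)
    show "N \<subseteq> vertices \<Gamma>"
      unfolding vertices_def using Y n by auto
  next
    fix Y assume "Y \<subseteq> N \<and> Y \<noteq> {} \<and> face_dim Y \<le> int n - 1"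
    then show "Y \<in> \<Gamma>"
      using Y unfolding face_dim_def by auto
  qed
qed

section \<open>Labelings up to order, and cliques at a common top vertex\<close>

text \<open>
  Naming the common top vertex, instead of comparing \<open>Max (l ` F)\<close>, makes the condition depend only
  on the order induced by the labeling.
\<close>

definition E_labeling :: "'a set set \<Rightarrow> ('a \<Rightarrow> nat) \<Rightarrow> bool" where
  "E_labeling \<Gamma> l \<longleftrightarrow>
     (\<forall>F\<in>facets \<Gamma>. \<forall>G\<in>facets \<Gamma>. \<forall>v\<in>F \<inter> G.
        F \<noteq> G \<and> card F = card G \<and> (\<forall>x\<in>F \<union> G. l x \<le> l v) \<longrightarrow>
        (\<forall>H. H \<subseteq> F \<union> G \<and> card H = card F \<longrightarrow> H \<in> \<Gamma>))"

lemma E_labelingD: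
  assumes "E_labeling \<Gamma> l" "F \<in> facets \<Gamma>" "G \<in> facets \<Gamma>" "v \<in> F" "v \<in> G" "F \<noteq> G"
    "card F = card G" "\<And>x. x \<in> F \<union> G \<Longrightarrow> l x \<le> l v" "H \<subseteq> F \<union> G" "card H = card F"
  shows "H \<in> \<Gamma>"
  using assms unfolding E_labeling_def by blast

text \<open>Injectivity forces the two vertices that attain equal maxima to coincide.\<close>

lemma Max_image_eq_iff:
  fixes l :: "'a \<Rightarrow> 'b::linorder"
  assumes "inj_on l V" "F \<subseteq> V" "G \<subseteq> V" "finite F" "finite G" "F \<noteq> {}" "G \<noteq> {}"
  shows "Max (l ` F) = Max (l ` G) \<longleftrightarrow> (\<exists>v\<in>F \<inter> G. \<forall>x\<in>F \<union> G. l x \<le> l v)"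
proof
  assume eq: "Max (l ` F) = Max (l ` G)"
  have "Max (l ` F) \<in> l ` F"
    using assms(4,6) by (intro Max_in) auto
  then obtain v where v: "Max (l ` F) = l v" "v \<in> F"
    by (rule imageE)
  have "Max (l ` G) \<in> l ` G"
    using assms(5,7) by (intro Max_in) auto
  then obtain w where w: "Max (l ` G) = l w" "w \<in> G"
    by (rule imageE)
  have "v = w"
    using inj_onD[OF assms(1), of v w] v w eq assms(2,3) by auto
  moreover have "l x \<le> l v" if "x \<in> F \<union> G" for x
    using that eq v assms(4,5) Max_ge[of "l ` F" "l x"] Max_ge[of "l ` G" "l x"] by auto
  ultimately show "\<exists>v\<in>F \<inter> G. \<forall>x\<in>F \<union> G. l x \<le> l v"
    using v w by blast
next
  assume "\<exists>v\<in>F \<inter> G. \<forall>x\<in>F \<union> G. l x \<le> l v"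
  then obtain v where v: "v \<in> F" "v \<in> G" "\<forall>x\<in>F \<union> G. l x \<le> l v"
    by blast
  then have "Max (l ` F) = l v" "Max (l ` G) = l v"
    using assms by (auto intro!: Max_eqI)
  then show "Max (l ` F) = Max (l ` G)"
    by simp
qed

text \<open>Replace each label by its rank, the number of elements of \<open>V\<close> whose label
  is not larger. This closes the gaps in the range and keeps the order.\<close>

lemma order_preserving_labeling:
  fixes l :: "'a \<Rightarrow> nat"
  assumes "finite V" "inj_on l V"
  obtains k :: "'a \<Rightarrow> nat" where "bij_betw k V {1..card V}"
    "\<And>x y. x \<in> V \<Longrightarrow> y \<in> V \<Longrightarrow> k x \<le> k y \<longleftrightarrow> l x \<le> l y"
proof -
  define k where "k x = card {y \<in> V. l y \<le> l x}" for x
  have mono: "k x \<le> k y" if "l x \<le> l y" for x y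
    unfolding k_def using assms(1) that by (intro card_mono) auto
  have strict: "k x < k y" if "y \<in> V" "l x < l y" for x y
    unfolding k_def
  proof (rule psubset_card_mono)
    show "{z \<in> V. l z \<le> l x} \<subset> {z \<in> V. l z \<le> l y}"
      using that by (auto simp: psubset_eq set_eq_iff intro!: exI[of _ y])
  qed (use assms(1) in auto)
  have iff: "k x \<le> k y \<longleftrightarrow> l x \<le> l y" if "x \<in> V" "y \<in> V" for x y
    using mono strict that by (meson leD not_le)
  have inj: "inj_on k V"
  proof (rule inj_onI)
    fix x y assume xy: "x \<in> V" "y \<in> V" "k x = k y"
    then have "l x = l y"
      using iff[of x y] iff[of y x] by simp
    then show "x = y"
      using xy assms(2) by (metis inj_onD)
  qed
  have "k ` V \<subseteq> {1..card V}"
  proof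
    fix i assume "i \<in> k ` V"
    then obtain x where x: "x \<in> V" "i = k x"
      by blast
    have "{x} \<subseteq> {y \<in> V. l y \<le> l x}"
      using x by auto
    then have "1 \<le> k x"
      unfolding k_def using assms(1) card_mono[of "{y \<in> V. l y \<le> l x}" "{x}"] by simp
    moreover have "k x \<le> card V"
      unfolding k_def using assms(1) by (intro card_mono) auto
    ultimately show "i \<in> {1..card V}"
      using x by simp
  qed
  then have "k ` V = {1..card V}"
    by (intro card_subset_eq) (auto simp: card_image[OF inj])
  with inj iff that show ?thesis
    unfolding bij_betw_def by blast
qed

text \<open>Since only the order of the labels matters, any injection into the naturals may serve as
  a labeling. This frees later constructions from hitting the range \<open>{1..card V}\<close>
  exactly.\<close>

lemma E_chordal_iff:
  assumes cx: "simplicial_complex \<Gamma>"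
  shows "E_chordal \<Gamma> \<longleftrightarrow> (\<exists>l. inj_on l (vertices \<Gamma>) \<and> E_labeling \<Gamma> l)"
proof -
  have Max: "Max (l ` F) = Max (l ` G) \<longleftrightarrow> (\<exists>v\<in>F \<inter> G. \<forall>x\<in>F \<union> G. l x \<le> l v)"
    if "inj_on l (vertices \<Gamma>)" "F \<in> facets \<Gamma>" "G \<in> facets \<Gamma>" "F \<noteq> G"
    for l :: "'a \<Rightarrow> nat" and F G
  proof (rule Max_image_eq_iff[OF that(1)])
    \<comment> \<open>An empty facet would be the only facet, so two distinct facets are both
      nonempty and their maxima are meaningful.\<close>
    show "F \<noteq> {}" "G \<noteq> {}"
      using that(2-4) unfolding facets_def by auto
  qed (use that cx facet_is_face face_finite face_subset_vertices in blast)+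
  have E: "E_labeling \<Gamma> l \<longleftrightarrow>
     (\<forall>F\<in>facets \<Gamma>. \<forall>G\<in>facets \<Gamma>.
           F \<noteq> G \<and> card F = card G \<and> Max (l ` F) = Max (l ` G) \<longrightarrow>
           (\<forall>H. H \<subseteq> F \<union> G \<and> card H = card F \<longrightarrow> H \<in> \<Gamma>))"
    if "inj_on l (vertices \<Gamma>)" for l
    unfolding E_labeling_def
  proof (intro ball_cong refl)
    fix F G assume FG: "F \<in> facets \<Gamma>" "G \<in> facets \<Gamma>"
    show "(\<forall>v\<in>F \<inter> G. F \<noteq> G \<and> card F = card G \<and> (\<forall>x\<in>F \<union> G. l x \<le> l v) \<longrightarrow>
        (\<forall>H. H \<subseteq> F \<union> G \<and> card H = card F \<longrightarrow> H \<in> \<Gamma>)) \<longleftrightarrow>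
      (F \<noteq> G \<and> card F = card G \<and> Max (l ` F) = Max (l ` G) \<longrightarrow>
        (\<forall>H. H \<subseteq> F \<union> G \<and> card H = card F \<longrightarrow> H \<in> \<Gamma>))"
    proof (cases "F = G")
      case False
      show ?thesis
        unfolding Max[OF that FG False] by blast
    qed simp
  qed
  show ?thesis
  proof
    assume "E_chordal \<Gamma>"
    then show "\<exists>l. inj_on l (vertices \<Gamma>) \<and> E_labeling \<Gamma> l"
      unfolding E_chordal_def vertex_labeling_def using E by (metis bij_betw_imp_inj_on)
  next
    assume "\<exists>l. inj_on l (vertices \<Gamma>) \<and> E_labeling \<Gamma> l"
    then obtain l where l: "inj_on l (vertices \<Gamma>)" "E_labeling \<Gamma> l"
      by blast
    obtain k :: "'a \<Rightarrow> nat" where k: "bij_betw k (vertices \<Gamma>) {1..card (vertices \<Gamma>)}"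
      and kl: "\<And>x y. x \<in> vertices \<Gamma> \<Longrightarrow> y \<in> vertices \<Gamma> \<Longrightarrow> k x \<le> k y \<longleftrightarrow> l x \<le> l y"
      using order_preserving_labeling[OF finite_vertices[OF cx] l(1)] by blast
    have "E_labeling \<Gamma> k"
      unfolding E_labeling_def
    proof (intro ballI impI allI)
      fix F G v H
      assume FG: "F \<in> facets \<Gamma>" "G \<in> facets \<Gamma>" "v \<in> F \<inter> G"
        "F \<noteq> G \<and> card F = card G \<and> (\<forall>x\<in>F \<union> G. k x \<le> k v)" "H \<subseteq> F \<union> G \<and> card H = card F"
      have "F \<union> G \<subseteq> vertices \<Gamma>"
        using FG face_subset_vertices[OF cx] facet_is_face by blast
      then have "l x \<le> l v" if "x \<in> F \<union> G" for x
        using FG kl that by blast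
      then show "H \<in> \<Gamma>"
        using E_labelingD[OF l(2) FG(1,2), of v H] FG by blast
    qed
    with k show "E_chordal \<Gamma>"
      unfolding E_chordal_def vertex_labeling_def E[OF bij_betw_imp_inj_on[OF k]] 
      by (intro exI[of _ k] conjI)
  qed
qed

text \<open>
  Fix a face \<open>F0\<close> of the family and induct on \<open>card (H - F0)\<close>: exchanging some \<open>x \<in> H - F0\<close> for
  some \<open>r \<in> F0 - H\<close>, with \<open>r = v\<close> unless \<open>v \<in> H\<close>, gives a face \<open>H'\<close> with top \<open>v\<close>, and \<open>H\<close> lies in
  the union of \<open>H'\<close> and a face of the family containing \<open>x\<close>.
\<close>

lemma E_labeling_clique:
  assumes cx: "simplicial_complex \<Gamma>" and E: "E_labeling \<Gamma> l"
    and top: "\<forall>F\<in>\<Gamma>. card F \<le> n" and n: "n > 0"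
    and H: "H \<subseteq> \<Union>{F \<in> \<Gamma>. card F = n \<and> v \<in> F \<and> (\<forall>x\<in>F. l x \<le> l v)}" "card H = n"
  shows "H \<in> \<Gamma>"
proof -
  define \<G> where "\<G> = {F \<in> \<Gamma>. card F = n \<and> v \<in> F \<and> (\<forall>x\<in>F. l x \<le> l v)}"
  have "H \<noteq> {}"
    using H n by auto
  then obtain F0 where F0: "F0 \<in> \<G>"
    using H unfolding \<G>_def by blast
  have fin: "finite F0"
    using F0 cx face_finite unfolding \<G>_def by blast
  have "H \<subseteq> \<Union>\<G>"
    using H unfolding \<G>_def by blast
  then show ?thesis
    using H(2)
  proof (induction "card (H - F0)" arbitrary: H rule: less_induct)
    case less
    have finH: "finite H"
      using less.prems n card.infinite by fastforce
    show ?case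
    proof (cases "H \<subseteq> F0")
      case True
      then have "H = F0"
        using F0 less.prems fin unfolding \<G>_def by (simp add: card_subset_eq)
      then show ?thesis
        using F0 unfolding \<G>_def by blast
    next
      case False
      then obtain x where x: "x \<in> H" "x \<notin> F0"
        by blast
      then obtain F where F: "F \<in> \<G>" "x \<in> F"
        using less.prems by blast
      have "\<not> F0 \<subseteq> H"
        using x F0 less.prems card_subset_eq[OF finH, of F0] unfolding \<G>_def by auto
      then obtain r where r: "r \<in> F0" "r \<notin> H" "v \<notin> H \<longrightarrow> r = v"
        using F0 unfolding \<G>_def by blast
      define H' where "H' = insert r (H - {x})"
      \<comment> \<open>If \<open>v\<close> already lies in \<open>H\<close>, the exchange keeps it:
        the removed \<open>x\<close> is outside \<open>F0\<close>, whereas \<open>v\<close> belongs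
        to \<open>F0\<close>.\<close>
      have v: "v \<in> H'"
        using r x F0 unfolding H'_def \<G>_def by auto
      have sub: "H' \<subseteq> \<Union>\<G>"
        using less.prems r F0 unfolding H'_def by blast
      have card: "card H' = n"
        using less.prems x r finH n unfolding H'_def by simp
      have "H' - F0 \<subset> H - F0"
        using x r unfolding H'_def by auto
      then have "card (H' - F0) < card (H - F0)"
        using finH by (simp add: psubset_card_mono)
      then have H': "H' \<in> \<Gamma>"
        using less.hyps[OF _ sub card] by simp
      have F': "F \<in> \<Gamma>" "card F = n" "v \<in> F"
        using F(1) unfolding \<G>_def by auto
      show ?thesis
      proof (rule E_labelingD[OF E])
        show "F \<in> facets \<Gamma>" "H' \<in> facets \<Gamma>"
          using card_max_imp_facet[OF cx top F'(1,2)] card_max_imp_facet[OF cx top H' card] .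
        show "v \<in> F" "v \<in> H'" "card F = card H'" "card H = card F"
          using F' v card less.prems by auto
        show "F \<noteq> H'"
          using F x r unfolding H'_def by auto
        show "l y \<le> l v" if "y \<in> F \<union> H'" for y
        proof -
          have "y \<in> \<Union>\<G>"
            using that F(1) sub by blast
          then show ?thesis
            unfolding \<G>_def by blast
        qed
        show "H \<subseteq> F \<union> H'"
          using F unfolding H'_def by blast
      qed
    qed
  qed
qed

subsection \<open>Vertex-chordal and E-chordal complexes\<close>

text \<open>The induction runs from the last deletion back to the first. Injectivity is asked on a
  fixed finite \<open>V\<close> because a deletion may lose further vertices along with the chosen
  one, and these still need distinct labels.\<close>

lemma vertex_reduction_E_labeling:
  assumes "(abdel_step d 0)\<^sup>*\<^sup>* \<Gamma> \<Gamma>'" "complex_dim \<Gamma>' \<le> 0" "simplicial_complex \<Gamma>"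
    "\<forall>F\<in>\<Gamma>. face_dim F \<le> d" "finite V" "vertices \<Gamma> \<subseteq> V"
  shows "\<exists>l. inj_on l V \<and> E_labeling \<Gamma> l"
  using assms
proof (induction rule: converse_rtranclp_induct)
  case base
  obtain l :: "'a \<Rightarrow> nat" where "inj_on l V"
    using finite_imp_inj_to_nat_seg[OF \<open>finite V\<close>] by blast
  moreover have "E_labeling \<Gamma>' l"
    unfolding E_labeling_def
  proof (intro ballI impI allI)
    fix F G v H
    assume FG: "F \<in> facets \<Gamma>'" "G \<in> facets \<Gamma>'" "v \<in> F \<inter> G"
        "F \<noteq> G \<and> card F = card G \<and> (\<forall>x\<in>F \<union> G. l x \<le> l v)"
    \<comment> \<open>In dimension at most 0 a facet through \<open>v\<close> is just
      \<open>{v}\<close>, so no two distinct facets share a vertex and the condition is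
      vacuous.\<close>
    have "S = {v}" if "S \<in> facets \<Gamma>'" "v \<in> S" for S
    proof -
      have S: "S \<in> \<Gamma>'"
        using that facet_is_face by blast
      have "card S \<le> 1"
        using S base.prems complex_dim_le_iff[of \<Gamma>' 0] unfolding face_dim_def by fastforce
      then show ?thesis
        using face_finite[OF base.prems(2) S] that(2) card_le_Suc0_iff_eq[of S] by auto
    qed
    then show "H \<in> \<Gamma>'"
      using FG by blast
  qed
  ultimately show ?case
    by blast
next
  case (step \<Gamma> \<Gamma>\<^sub>1)
  note cx = \<open>simplicial_complex \<Gamma>\<close>
  obtain F where F: "face_dim F = 0" "simplicial_face d \<Gamma> F" "\<Gamma>\<^sub>1 = abdel F \<Gamma>"
    using step.hyps(1) unfolding abdel_step_def by blast
  then have "card F = 1"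
    unfolding face_dim_def by simp
  then obtain v where v: "F = {v}"
    using card_1_singletonE by blast
  have cx1: "simplicial_complex \<Gamma>\<^sub>1" and sub: "\<Gamma>\<^sub>1 \<subseteq> \<Gamma>"
    using simplicial_complex_abdel[OF cx] F by auto
  then have "vertices \<Gamma>\<^sub>1 \<subseteq> V"
    using step.prems unfolding vertices_def by blast
  then obtain k where k: "inj_on k V" "E_labeling \<Gamma>\<^sub>1 k"
    using step sub cx1 by blast
  \<comment> \<open>The deleted vertex is moved above all of \<open>V\<close>. Overwriting its old
    label does not disturb facets of \<open>\<Gamma>\<^sub>1\<close>, which avoid it.\<close>
  define m where "m = Suc (Max (k ` V))"
  have m: "k x < m" if "x \<in> V" for x
    unfolding m_def using that \<open>finite V\<close> by (simp add: le_imp_less_Suc)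
  define l where "l = k(v := m)"
  have "inj_on l V"
    using k(1) m unfolding l_def inj_on_def by (metis fun_upd_apply less_irrefl)
  moreover have "E_labeling \<Gamma> l"
    unfolding E_labeling_def
  proof (intro ballI impI allI)
    fix S G w H
    assume SG: "S \<in> facets \<Gamma>" "G \<in> facets \<Gamma>" "w \<in> S \<inter> G"
        "S \<noteq> G \<and> card S = card G \<and> (\<forall>x\<in>S \<union> G. l x \<le> l w)" "H \<subseteq> S \<union> G \<and> card H = card S"
    have V: "S \<union> G \<subseteq> V"
      using SG face_subset_vertices[OF cx] facet_is_face step.prems(5) by blast
    show "H \<in> \<Gamma>"
    proof (cases "w = v")
      case True
      have faces: "S \<in> \<Gamma>" "G \<in> \<Gamma>"
        using SG facet_is_face by auto
      \<comment> \<open>Each vertex of \<open>S\<close> or \<open>G\<close> spans a face with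
        \<open>v\<close>, so the clique condition on the star applies to \<open>H\<close>.\<close>
      have "S \<union> G \<subseteq> vertices (star F \<Gamma>)"
        unfolding vertices_star[OF cx] v using SG True faces face_subset[OF cx] by auto
      moreover have "H \<noteq> {}"
        using SG faces face_finite[OF cx] by (metis IntD1 card_0_eq card.empty empty_iff)
      moreover have "face_dim H \<le> d"
        using SG faces step.prems(3) unfolding face_dim_def by auto
      ultimately show ?thesis
        using F(2) SG(5) unfolding simplicial_face_def clique_def by blast
    next
      case False
      \<comment> \<open>Otherwise the label \<open>m\<close> of \<open>v\<close> would be at most
        that of \<open>w\<close>, which is smaller than \<open>m\<close> because \<open>w\<close>
        differs from \<open>v\<close>.\<close>
      have "v \<notin> S \<union> G"
      proof
        assume "v \<in> S \<union> G"
        then have "l v \<le> l w"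
          using SG by blast
        then show False
          using m[of w] False SG V unfolding l_def by fastforce
      qed
      then have "S \<in> facets \<Gamma>\<^sub>1" "G \<in> facets \<Gamma>\<^sub>1" and "\<And>x. x \<in> S \<union> G \<Longrightarrow> k x \<le> k w"
        using SG False facets_abdel[OF cx, of F] F v unfolding l_def
        by (auto split: if_splits)
      then have "H \<in> \<Gamma>\<^sub>1"
        using SG E_labelingD[OF k(2), of S G w H] by blast
      then show ?thesis
        using sub by blast
    qed
  qed
  ultimately show ?case
    by blast
qed

lemma vertex_chordal_imp_E_chordal:
  assumes cx: "simplicial_complex \<Delta>" and "vertex_chordal \<Delta>"
  shows "E_chordal \<Delta>"
proof -
  obtain \<Gamma> where "(abdel_step (complex_dim \<Delta>) 0)\<^sup>*\<^sup>* \<Delta> \<Gamma>" "complex_dim \<Gamma> \<le> 0"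
    using assms(2) unfolding vertex_chordal_def face_chordal_def by blast
  moreover have "\<forall>F\<in>\<Delta>. face_dim F \<le> complex_dim \<Delta>"
    using complex_dim_le_iff[OF cx] by blast
  ultimately show ?thesis
    using vertex_reduction_E_labeling[OF _ _ cx _ finite_vertices[OF cx]] E_chordal_iff[OF cx]
    by blast
qed

text \<open>The induction lowers a strict bound \<open>k\<close> on the labels; a value carried by
  no vertex of a surviving facet costs no deletion. Purity makes the star of the top vertex a union
  of faces with \<open>n\<close> vertices, which is what \<open>E_labeling_clique\<close>
  requires.\<close>

lemma pure_E_labeling_vertex_reduction:
  assumes cx: "simplicial_complex \<Delta>" and inj: "inj_on l (vertices \<Delta>)" and E: "E_labeling \<Delta> l"
    and pure: "\<forall>F\<in>facets \<Delta>. card F = n" and n: "n > 0"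
    and "simplicial_complex \<Gamma>" "facets \<Gamma> = {F \<in> facets \<Delta>. \<forall>x\<in>F. l x < k}"
  shows "\<exists>\<Gamma>'. (abdel_step (int n - 1) 0)\<^sup>*\<^sup>* \<Gamma> \<Gamma>' \<and> complex_dim \<Gamma>' \<le> 0"
  using assms(6,7)
proof (induction k arbitrary: \<Gamma>)
  case 0
  \<comment> \<open>No label is below 0 and every facet is nonempty, so the reduction ends at the
    void complex, of dimension -1.\<close>
  have "facets \<Gamma> = {}"
    using 0 pure n by auto
  then have "\<Gamma> = {}"
    using face_in_facet[OF 0(1)] by blast
  then have "complex_dim \<Gamma> \<le> 0"
    unfolding complex_dim_def by simp
  then show ?case
    by blast
next
  case (Suc k)
  have top: "\<forall>F\<in>\<Delta>. card F \<le> n"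
    using face_in_facet[OF cx] pure face_finite[OF cx] facet_is_face by (metis card_mono)
  show ?case
  proof (cases "\<exists>F\<in>facets \<Gamma>. \<exists>v\<in>F. l v = k")
    case False
    then have "facets \<Gamma> = {F \<in> facets \<Delta>. \<forall>x\<in>F. l x < k}"
      unfolding Suc.prems(2) using less_Suc_eq by auto
    then show ?thesis
      using Suc by blast
  next
    case True
    then obtain F0 v where F0: "F0 \<in> facets \<Gamma>" "v \<in> F0" "l v = k"
      by blast
    define N where "N = vertices (star {v} \<Gamma>)"
    have N: "\<exists>F\<in>facets \<Gamma>. v \<in> F \<and> x \<in> F" if "x \<in> N" for x
    proof -
      have "{x, v} \<in> \<Gamma>"
        using that vertices_star[OF Suc.prems(1)] unfolding N_def by auto
      then show ?thesis
        using face_in_facet[OF Suc.prems(1)] by (metis insert_subset)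
    qed
    have fac: "F \<in> facets \<Delta> \<and> F \<in> \<Delta> \<and> card F = n \<and> (\<forall>x\<in>F. l x \<le> l v)" if "F \<in> facets \<Gamma>" for F
      using that Suc.prems(2) pure facet_is_face[of F \<Delta>] F0(3) by auto
    have N_sub: "N \<subseteq> \<Union>{F \<in> \<Delta>. card F = n \<and> v \<in> F \<and> (\<forall>x\<in>F. l x \<le> l v)}"
    proof
      fix x assume "x \<in> N"
      then obtain F where "F \<in> facets \<Gamma>" "v \<in> F" "x \<in> F"
        using N by metis
      then show "x \<in> \<Union>{F \<in> \<Delta>. card F = n \<and> v \<in> F \<and> (\<forall>x\<in>F. l x \<le> l v)}"
        using fac[of F] by auto
    qed
    have "clique (int n - 1) \<Gamma> N"
    proof (rule cliqueI[OF Suc.prems(1) n])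
      have "N \<subseteq> vertices \<Delta>"
        using N_sub face_subset_vertices[OF cx] by fast
      then show "finite N"
        using finite_vertices[OF cx] finite_subset by blast
      show "F0 \<subseteq> N"
        unfolding N_def vertices_star[OF Suc.prems(1)]
        using F0 face_subset[OF Suc.prems(1) facet_is_face[OF F0(1)]] by auto
      show "card F0 = n"
        using F0 fac by blast
    next
      fix H assume H: "H \<subseteq> N" "card H = n"
      \<comment> \<open>The clique lemma places \<open>H\<close> in the original complex only. Its
        size makes it a facet there, and its labels are at most \<open>k\<close>, so it has not been
        deleted yet.\<close>
      have "H \<in> \<Delta>"
        using E_labeling_clique[OF cx E top n subset_trans[OF H(1) N_sub] H(2)] .
      then have "H \<in> facets \<Delta>"
        using card_max_imp_facet[OF cx top] H(2) by simp
      moreover have "l x < Suc k" if "x \<in> H" for x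
      proof -
        have "x \<in> \<Union>{F \<in> \<Delta>. card F = n \<and> v \<in> F \<and> (\<forall>x\<in>F. l x \<le> l v)}"
          using that H(1) N_sub by blast
        then show ?thesis
          using F0(3) by auto
      qed
      ultimately have "H \<in> facets \<Gamma>"
        unfolding Suc.prems(2) by simp
      then show "H \<in> \<Gamma>"
        using facet_is_face by blast
    qed
    moreover have "{v} \<in> \<Gamma>"
      using face_subset[OF Suc.prems(1) facet_is_face[OF F0(1)]] F0(2) by simp
    ultimately have step: "abdel_step (int n - 1) 0 \<Gamma> (abdel {v} \<Gamma>)"
      unfolding abdel_step_def simplicial_face_def N_def
      by (intro exI[of _ "{v}"]) (simp add: face_dim_def)
    \<comment> \<open>As \<open>v\<close> alone carries the label \<open>k\<close>, deleting above
      \<open>{v}\<close> removes exactly the facets in which \<open>k\<close> occurs.\<close>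
    have v_unique: "v = x" if "F \<in> facets \<Delta>" "x \<in> F" "l x = k" for F x
    proof -
      have "x \<in> vertices \<Delta>" "v \<in> vertices \<Delta>"
        using face_subset_vertices[OF cx] facet_is_face[OF that(1)] that(2) fac[OF F0(1)] F0(2)
        by auto
      then show ?thesis
        using inj_onD[OF inj, of v x] that F0 by simp
    qed
    have "(\<forall>x\<in>F. l x < Suc k) \<and> \<not> {v} \<subseteq> F \<longleftrightarrow> (\<forall>x\<in>F. l x < k)" if "F \<in> facets \<Delta>" for F
    proof
      assume F: "(\<forall>x\<in>F. l x < Suc k) \<and> \<not> {v} \<subseteq> F"
      show "\<forall>x\<in>F. l x < k"
      proof
        fix x assume "x \<in> F"
        then show "l x < k"
          using F v_unique[OF that, of x] by (auto simp: less_Suc_eq)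
      qed
    qed (use F0(3) in \<open>auto simp: less_Suc_eq\<close>)
    then have "facets (abdel {v} \<Gamma>) = {F \<in> facets \<Delta>. \<forall>x\<in>F. l x < k}"
      unfolding facets_abdel[OF Suc.prems(1)] Suc.prems(2) by blast
    then show ?thesis
      using Suc.IH[OF simplicial_complex_abdel(1)[OF Suc.prems(1)]]
        converse_rtranclp_into_rtranclp[of "abdel_step (int n - 1) 0", OF step] by blast
  qed
qed

lemma pure_E_chordal_imp_vertex_chordal:
  assumes cx: "simplicial_complex \<Delta>" and d: "complex_dim \<Delta> \<ge> 1" and pure: "pure_complex \<Delta>"
    and E: "E_chordal \<Delta>"
  shows "vertex_chordal \<Delta>"
proof -
  obtain F where F: "F \<in> \<Delta>" "face_dim F = complex_dim \<Delta>"
    using complex_dim_attained[OF cx] d by auto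
  define n where "n = card F"
  have n: "n > 0" "complex_dim \<Delta> = int n - 1"
    using F d unfolding n_def face_dim_def by auto
  have top: "\<forall>G\<in>\<Delta>. card G \<le> n"
    using complex_dim_le_iff[OF cx, of "complex_dim \<Delta>"] n(2) unfolding face_dim_def by auto
  have "F \<in> facets \<Delta>"
    using card_max_imp_facet[OF cx top F(1)] n_def by simp
  then have "face_dim G = face_dim F" if "G \<in> facets \<Delta>" for G
    using pure that unfolding pure_complex_def by metis
  then have n_facets: "\<forall>G\<in>facets \<Delta>. card G = n"
    unfolding n_def face_dim_def by simp
  obtain l where l: "inj_on l (vertices \<Delta>)" "E_labeling \<Delta> l"
    using E E_chordal_iff[OF cx] by blast
  \<comment> \<open>This starting bound exceeds every label, so the filter initially keeps all
    facets.\<close>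
  have "l x < Suc (Max (l ` vertices \<Delta>))" if "G \<in> facets \<Delta>" "x \<in> G" for G x
  proof -
    have "x \<in> vertices \<Delta>"
      using that face_subset_vertices[OF cx] facet_is_face by blast
    then show ?thesis
      using finite_vertices[OF cx] by (simp add: le_imp_less_Suc)
  qed
  then have "facets \<Delta> = {G \<in> facets \<Delta>. \<forall>x\<in>G. l x < Suc (Max (l ` vertices \<Delta>))}"
    by blast
  from pure_E_labeling_vertex_reduction[OF cx l n_facets n(1) cx this] show ?thesis
    unfolding vertex_chordal_def face_chordal_def n(2) using d n(2) by simp
qed

subsection \<open>E-chordal complexes are ridge-chordal\<close>

text \<open>For injective \<open>l\<close> this is \<open>set_encode\<close> of the set of labels:
  two finite sets are compared at the largest label in which they differ.\<close>

definition binary_weight :: "('a \<Rightarrow> nat) \<Rightarrow> 'a set \<Rightarrow> nat" where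
  "binary_weight l A = (\<Sum>x\<in>A. 2 ^ l x)"

text \<open>Phrased without choosing a minimum, so that it is total. On a nonempty finite set with
  injective labels exactly one vertex is dropped.\<close>

definition non_minimal :: "('a \<Rightarrow> nat) \<Rightarrow> 'a set \<Rightarrow> 'a set" where
  "non_minimal l A = {x \<in> A. \<exists>y\<in>A. l y < l x}"

text \<open>Binary expansions are unique.\<close>

lemma binary_weight_inj:
  assumes "inj_on l V" "A \<subseteq> V" "B \<subseteq> V" "finite A" "finite B"
    "binary_weight l A = binary_weight l B"
  shows "A = B"
proof -
  have "binary_weight l S = set_encode (l ` S)" if "S \<subseteq> V" for S
    unfolding binary_weight_def set_encode_def
    using inj_on_subset[OF assms(1) that] by (simp add: sum.reindex)
  then have "l ` A = l ` B"
    using assms by (metis finite_imageI set_encode_eq)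
  then show ?thesis
    using assms inj_on_image_eq_iff by metis
qed

text \<open>The two differences have equal size and are separated by the least label
  \<open>m\<close> of \<open>A - B\<close>: summands over \<open>B - A\<close> are at most
  \<open>2 ^ m\<close>, those over \<open>A - B\<close> at least \<open>2 ^ m\<close>.\<close>

lemma binary_weight_exchange:
  assumes "finite A" "finite B" "card A = card B"
    "\<And>a b. a \<in> A - B \<Longrightarrow> b \<in> B - A \<Longrightarrow> l b \<le> l a"
  shows "binary_weight l B \<le> binary_weight l A"
proof -
  have card: "card (A - B) = card (B - A)"
    using assms(1-3) by (simp add: card_Diff_subset_Int Int_commute)
  have "sum (\<lambda>x. 2 ^ l x) (B - A) \<le> (sum (\<lambda>x. 2 ^ l x) (A - B) :: nat)"
  proof (cases "A - B = {}")
    case True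
    then have "B - A = {}"
      using card assms(2) by (metis card.empty card_0_eq finite_Diff)
    then show ?thesis
      using True by simp
  next
    case False
    define m where "m = Min (l ` (A - B))"
    have "m \<in> l ` (A - B)"
      unfolding m_def using False assms(1) by (intro Min_in) auto
    then have B: "l b \<le> m" if "b \<in> B - A" for b
      using assms(4) that by auto
    have A: "m \<le> l a" if "a \<in> A - B" for a
      unfolding m_def using that assms(1) by simp
    have "sum (\<lambda>x. 2 ^ l x) (B - A) \<le> card (B - A) * (2::nat) ^ m"
      using sum_bounded_above[of "B - A" "\<lambda>x. (2::nat) ^ l x" "2 ^ m"] B by simp
    also have "\<dots> \<le> sum (\<lambda>x. 2 ^ l x) (A - B)"
      using sum_bounded_below[of "A - B" "(2::nat) ^ m" "\<lambda>x. 2 ^ l x"] A card by simp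
    finally show ?thesis .
  qed
  then show ?thesis
    unfolding binary_weight_def
    using sum.Int_Diff[OF assms(1), of "\<lambda>x. (2::nat) ^ l x" B]
      sum.Int_Diff[OF assms(2), of "\<lambda>x. (2::nat) ^ l x" A]
    by (simp add: Int_commute)
qed

lemma non_minimal_eq:
  assumes "m \<in> A" "\<forall>y\<in>A - {m}. l m < l y"
  shows "non_minimal l A = A - {m}"
proof -
  have "\<not> l y < l m" if "y \<in> A" for y
    using bspec[OF assms(2), of y] that by (cases "y = m") auto
  with assms show ?thesis
    unfolding non_minimal_def by blast
qed

lemma obtain_minimal:
  fixes l :: "'a \<Rightarrow> nat"
  assumes "finite A" "A \<noteq> {}" "inj_on l A"
  obtains m where "m \<in> A" "\<forall>y\<in>A - {m}. l m < l y"
proof -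
  have "Min (l ` A) \<in> l ` A"
    using assms by (intro Min_in) auto
  then obtain m where m: "m \<in> A" "l m = Min (l ` A)"
    by force
  have "l m < l y" if "y \<in> A - {m}" for y
  proof -
    have "l m \<le> l y"
      using m that assms by simp
    moreover have "l m \<noteq> l y"
      using m that assms(3) by (metis DiffD1 DiffD2 inj_onD singletonI)
    ultimately show ?thesis
      by simp
  qed
  with m that show ?thesis
    by blast
qed

text \<open>After the insertion \<open>m\<close> is still the smallest vertex, so it leaves while
  \<open>x\<close>, with a larger label, enters.\<close>

lemma binary_weight_non_minimal_insert:
  assumes "finite R" "m \<in> R" "x \<notin> R" "\<forall>y\<in>R - {m}. l m < l y" "l m < l x"
  shows "binary_weight l R < binary_weight l (non_minimal l (insert x R))"
proof -
  have "non_minimal l (insert x R) = insert x R - {m}"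
    using assms by (intro non_minimal_eq) auto
  also have "\<dots> = insert x (R - {m})"
    using assms by blast
  finally have "binary_weight l (non_minimal l (insert x R)) = 2 ^ l x + binary_weight l (R - {m})"
    using assms unfolding binary_weight_def by simp
  moreover have "binary_weight l R = 2 ^ l m + binary_weight l (R - {m})"
    unfolding binary_weight_def using assms by (simp add: sum.remove)
  ultimately show ?thesis
    using assms(5) by simp
qed

text \<open>The invariant is that the surviving faces with \<open>n\<close> vertices form a
  down-set, with respect to the weight of their non-minimal part, among all such faces of
  \<open>\<Delta>\<close>. The induction is on their number.\<close>

lemma E_labeling_ridge_reduction:
  assumes cx: "simplicial_complex \<Delta>" and inj: "inj_on l (vertices \<Delta>)" and E: "E_labeling \<Delta> l"
    and top: "\<forall>F\<in>\<Delta>. card F \<le> n" and n: "n \<ge> 2"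
    and "simplicial_complex \<Gamma>" "\<Gamma> \<subseteq> \<Delta>"
    and "\<And>A B. A \<in> \<Gamma> \<Longrightarrow> card A = n \<Longrightarrow> B \<in> \<Delta> \<Longrightarrow> card B = n \<Longrightarrow>
       binary_weight l (non_minimal l B) \<le> binary_weight l (non_minimal l A) \<Longrightarrow> B \<in> \<Gamma>"
  shows "\<exists>\<Gamma>'. (abdel_step (int n - 1) (int n - 2))\<^sup>*\<^sup>* \<Gamma> \<Gamma>' \<and> complex_dim \<Gamma>' \<le> int n - 2"
  using assms(6-)
proof (induction "card {F \<in> \<Gamma>. card F = n}" arbitrary: \<Gamma> rule: less_induct)
  case less
  note cx\<Gamma> = less.prems(1) and sub = less.prems(2) and closed = less.prems(3)
  define \<E> where "\<E> = {F \<in> \<Gamma>. card F = n}"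
  define key where "key F = binary_weight l (non_minimal l F)" for F
  have fin: "finite \<E>"
    using cx\<Gamma> unfolding \<E>_def simplicial_complex_def by simp
  have face: "finite F" "inj_on l F" "F \<subseteq> vertices \<Delta>" if "F \<in> \<Delta>" for F
    using face_finite[OF cx that] face_subset_vertices[OF cx that] inj_on_subset[OF inj] by auto
  show ?case
  proof (cases "\<E> = {}")
    case True
    have "face_dim F \<le> int n - 2" if "F \<in> \<Gamma>" for F
    proof -
      have "card F \<le> n" "card F \<noteq> n"
        using that True top sub unfolding \<E>_def by auto
      then show ?thesis
        unfolding face_dim_def by simp
    qed
    then have "complex_dim \<Gamma> \<le> int n - 2"
      using complex_dim_le_iff[OF cx\<Gamma>] n by simp
    then show ?thesis
      by blast
  next
    case False
    have "Max (key ` \<E>) \<in> key ` \<E>"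
      using False fin by (intro Max_in) auto
    then obtain D where D: "D \<in> \<E>" "key D = Max (key ` \<E>)"
      by (metis imageE)
    have max: "key F \<le> key D" if "F \<in> \<E>" for F
      using D fin that by simp
    have D': "D \<in> \<Gamma>" "D \<in> \<Delta>" "card D = n"
      using D sub unfolding \<E>_def by auto
    have "D \<noteq> {}"
      using D'(3) n by auto
    then obtain m where m: "m \<in> D" "\<forall>y\<in>D - {m}. l m < l y"
      using obtain_minimal[OF face(1)[OF D'(2)] _ face(2)[OF D'(2)]] by blast
    define R where "R = D - {m}"
    have "non_minimal l D = R"
      unfolding R_def using m by (rule non_minimal_eq)
    then have keyD: "key D = binary_weight l R"
      unfolding key_def by simp
    have finR: "finite R" and cardR: "card R = n - 1" and injR: "inj_on l R"
      using face[OF D'(2)] D' m(1) unfolding R_def by (auto intro: inj_on_subset)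
    have "R \<noteq> {}"
      using cardR n by auto
    obtain r where r: "r \<in> R" "\<forall>y\<in>R - {r}. l r < l y"
      using obtain_minimal[OF finR \<open>R \<noteq> {}\<close> injR] by blast
    \<comment> \<open>The largest vertex \<open>v\<close> of the ridge will be the common top vertex
      for \<open>E_labeling_clique\<close>.\<close>
    have "Max (l ` R) \<in> l ` R"
      using \<open>R \<noteq> {}\<close> finR by (intro Max_in) auto
    then obtain v where v: "v \<in> R" "l v = Max (l ` R)"
      by (metis imageE)
    have v_max: "l y \<le> l v" if "y \<in> R" for y
      using that v finR by simp
    \<comment> \<open>If \<open>x\<close> were above the smallest vertex \<open>r\<close> of
      \<open>R\<close>, the face \<open>insert x R\<close> would be heavier than \<open>D\<close>,
      against the choice of \<open>D\<close>.\<close>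
    have below: "l x < l r" if "x \<notin> R" "insert x R \<in> \<Gamma>" for x
    proof (rule ccontr)
      assume "\<not> l x < l r"
      moreover have "l x \<noteq> l r"
        using inj_onD[OF face(2)[of "insert x R"], of x r] that sub r(1) by auto
      ultimately have "l r < l x"
        by simp
      from binary_weight_non_minimal_insert[OF finR r(1) that(1) r(2) this]
      have "key D < key (insert x R)"
        using keyD unfolding key_def by simp
      moreover have "insert x R \<in> \<E>"
        using that cardR finR n unfolding \<E>_def by simp
      ultimately show False
        using max[of "insert x R"] by simp
    qed
    have r_le: "l r \<le> l y" if "y \<in> R" for y
      using bspec[OF r(2), of y] that by (cases "y = r") auto
    \<comment> \<open>The vertex added to \<open>R\<close> is the smallest one, so every surviving
      top-dimensional face above \<open>R\<close> has the same weight as \<open>D\<close>.\<close>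
    have keyR: "non_minimal l F = R" if "R \<subseteq> F" "F \<in> \<E>" for F
    proof -
      have F: "F \<in> \<Gamma>" "card F = n" "finite F"
        using that sub face(1) unfolding \<E>_def by auto
      then have "card (F - R) = 1"
        using that cardR finR n by (simp add: card_Diff_subset)
      then obtain x where x: "F - R = {x}"
        using card_1_singletonE by blast
      then have x': "F = insert x R" "x \<notin> R"
        using that by auto
      then have "l x < l y" if "y \<in> R" for y
        using below[of x] F r_le[OF that] by simp
      then have "non_minimal l F = F - {x}"
        using x' by (intro non_minimal_eq) auto
      then show ?thesis
        using x' by auto
    qed
    define N where "N = vertices (star R \<Gamma>)"
    have N: "insert x R \<in> \<Gamma>" if "x \<in> N" for x
      using that vertices_star[OF cx\<Gamma>] unfolding N_def by auto
    have RN: "R \<in> \<Gamma>"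
      using face_subset[OF cx\<Gamma> D'(1)] unfolding R_def by blast
    have DN: "D \<subseteq> N"
      unfolding N_def vertices_star[OF cx\<Gamma>] using face_subset[OF cx\<Gamma> D'(1)] m(1) unfolding R_def
      by auto
    have low: "l x < l y" if "x \<in> N - R" "y \<in> R" for x y
      using below[of x] N[of x] that r_le[OF that(2)] by simp
    \<comment> \<open>Vertices of \<open>R\<close> are covered by \<open>D\<close>, any other
      \<open>x\<close> by \<open>insert x R\<close>. In both faces the vertex outside
      \<open>R\<close> has a label at most that of \<open>v\<close>, so \<open>v\<close> is on
      top.\<close>
    have N_sub: "N \<subseteq> \<Union>{F \<in> \<Delta>. card F = n \<and> v \<in> F \<and> (\<forall>x\<in>F. l x \<le> l v)}"
    proof
      fix x assume x: "x \<in> N"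
      have "\<exists>F\<in>\<Delta>. card F = n \<and> R \<subseteq> F \<and> x \<in> F \<and> (\<forall>y\<in>F - R. l y \<le> l v)"
      proof (cases "x \<in> R")
        case True
        have "l m \<le> l v"
          using bspec[OF m(2), of v] v(1) unfolding R_def by simp
        then have "\<forall>y\<in>D - R. l y \<le> l v"
          unfolding R_def by auto
        moreover have "R \<subseteq> D" "x \<in> D"
          using True unfolding R_def by auto
        ultimately show ?thesis
          using D'(2,3) by blast
      next
        case False
        have "l x \<le> l v"
          using low[of x v] x False v(1) by simp
        moreover have "card (insert x R) = n"
          using finR cardR n False by simp
        ultimately show ?thesis
          using N[OF x] sub by (intro bexI[of _ "insert x R"]) auto
      qed
      then obtain F where "F \<in> \<Delta>" "card F = n" "R \<subseteq> F" "x \<in> F" "\<forall>y\<in>F - R. l y \<le> l v"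
        by blast
      moreover from this have "\<forall>y\<in>F. l y \<le> l v"
        using v_max by blast
      ultimately show "x \<in> \<Union>{F \<in> \<Delta>. card F = n \<and> v \<in> F \<and> (\<forall>x\<in>F. l x \<le> l v)}"
        using v(1) by blast
    qed
    have "clique (int n - 1) \<Gamma> N"
    proof (rule cliqueI[OF cx\<Gamma> _ _ DN D'(3)])
      show "n > 0"
        using n by simp
      have "N \<subseteq> vertices \<Delta>"
        using N_sub face(3) by fast
      then show "finite N"
        using finite_vertices[OF cx] finite_subset by blast
    next
      fix H assume H: "H \<subseteq> N" "card H = n"
      have "H \<in> \<Delta>"
        using E_labeling_clique[OF cx E top _ subset_trans[OF H(1) N_sub] H(2)] n by simp
      \<comment> \<open>Without its smallest vertex, \<open>H\<close> has as many elements as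
        \<open>R\<close>, and those outside \<open>R\<close> lie below all of \<open>R\<close>; the
        exchange bound applies.\<close>
      moreover have "key H \<le> key D"
      proof -
        have "H \<noteq> {}"
          using H(2) n by auto
        then obtain h where h: "h \<in> H" "\<forall>y\<in>H - {h}. l h < l y"
          using obtain_minimal[OF face(1)[OF \<open>H \<in> \<Delta>\<close>] _ face(2)[OF \<open>H \<in> \<Delta>\<close>]] by blast
        then have "non_minimal l H = H - {h}"
          by (rule non_minimal_eq)
        then have "key H = binary_weight l (H - {h})"
          unfolding key_def by simp
        also have "\<dots> \<le> binary_weight l R"
        proof (rule binary_weight_exchange[OF finR])
          show "finite (H - {h})" "card R = card (H - {h})"
            using face(1)[OF \<open>H \<in> \<Delta>\<close>] cardR h(1) H by auto
          show "l b \<le> l a" if "a \<in> R - (H - {h})" "b \<in> (H - {h}) - R" for a b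
            using low[of b a] that H(1) by auto
        qed
        finally show ?thesis
          unfolding keyD .
      qed
      ultimately show "H \<in> \<Gamma>"
        using closed[OF D'(1,3) _ H(2)] unfolding key_def by blast
    qed
    moreover have "face_dim R = int n - 2"
      unfolding face_dim_def using cardR n by simp
    ultimately have step: "abdel_step (int n - 1) (int n - 2) \<Gamma> (abdel R \<Gamma>)"
      unfolding abdel_step_def simplicial_face_def using RN unfolding N_def by blast
    have sub': "abdel R \<Gamma> \<subseteq> \<Gamma>" and cx': "simplicial_complex (abdel R \<Gamma>)"
      using simplicial_complex_abdel[OF cx\<Gamma>] by auto
    have top': "\<forall>F\<in>\<Gamma>. card F \<le> n"
      using top sub by blast
    \<comment> \<open>Faces with \<open>n\<close> vertices are facets, so for them deletion is plain
      filtering.\<close>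
    have abdel: "F \<in> abdel R \<Gamma> \<longleftrightarrow> F \<in> \<Gamma> \<and> \<not> R \<subseteq> F" if "card F = n" for F
    proof
      assume F: "F \<in> abdel R \<Gamma>"
      then have "F \<in> facets (abdel R \<Gamma>)"
        using card_max_imp_facet[OF cx' _ F that] top' sub' by blast
      then show "F \<in> \<Gamma> \<and> \<not> R \<subseteq> F"
        unfolding facets_abdel[OF cx\<Gamma>] using facet_is_face by blast
    next
      assume "F \<in> \<Gamma> \<and> \<not> R \<subseteq> F"
      then have "F \<in> facets (abdel R \<Gamma>)"
        unfolding facets_abdel[OF cx\<Gamma>] using card_max_imp_facet[OF cx\<Gamma> top' _ that] by blast
      then show "F \<in> abdel R \<Gamma>"
        by (rule facet_is_face)
    qed
    have "{F \<in> abdel R \<Gamma>. card F = n} \<subset> \<E>"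
      using abdel D sub' unfolding \<E>_def R_def by blast
    then have "card {F \<in> abdel R \<Gamma>. card F = n} < card {F \<in> \<Gamma>. card F = n}"
      using fin psubset_card_mono unfolding \<E>_def by blast
    moreover have "B \<in> abdel R \<Gamma>"
      if A: "A \<in> abdel R \<Gamma>" "card A = n" and B: "B \<in> \<Delta>" "card B = n" and le: "key B \<le> key A"
      for A B
    proof -
      have A': "A \<in> \<E>" "\<not> R \<subseteq> A"
        using A abdel unfolding \<E>_def by auto
      have "B \<in> \<Gamma>"
        using closed[OF _ A(2) B] A'(1) le unfolding \<E>_def key_def by blast
      \<comment> \<open>If \<open>B\<close> contained \<open>R\<close>, it would have the maximal
        weight, hence so would \<open>A\<close>. Injectivity of the weight then makes
        \<open>R\<close> the non-minimal part of \<open>A\<close>, although \<open>A\<close>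
        survived the deletion above \<open>R\<close>.\<close>
      moreover have "\<not> R \<subseteq> B"
      proof
        assume "R \<subseteq> B"
        then have "key B = key D"
          using keyR[of B] \<open>B \<in> \<Gamma>\<close> B keyD unfolding \<E>_def key_def by simp
        then have "key A = key D"
          using le max[OF A'(1)] by simp
        then have eq: "binary_weight l (non_minimal l A) = binary_weight l R"
          using keyD unfolding key_def by simp
        have "A \<in> \<Delta>"
          using A' sub unfolding \<E>_def by blast
        moreover have "non_minimal l A \<subseteq> A"
          unfolding non_minimal_def by blast
        moreover have "R \<subseteq> vertices \<Delta>"
          using face(3)[OF D'(2)] unfolding R_def by blast
        ultimately have "non_minimal l A = R"
          using binary_weight_inj[OF inj _ _ _ finR eq] face(1,3)[of A] finite_subset by blast
        then show False
          using A' \<open>non_minimal l A \<subseteq> A\<close> by blast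
      qed
      ultimately show ?thesis
        using abdel B by blast
    qed
    ultimately have "\<exists>\<Gamma>'. (abdel_step (int n - 1) (int n - 2))\<^sup>*\<^sup>* (abdel R \<Gamma>) \<Gamma>' \<and>
        complex_dim \<Gamma>' \<le> int n - 2"
      unfolding key_def by (rule less.hyps[OF _ cx' subset_trans[OF sub' sub]])
    then show ?thesis
      using converse_rtranclp_into_rtranclp[of "abdel_step (int n - 1) (int n - 2)", OF step]
      by blast
  qed
qed

lemma E_chordal_imp_ridge_chordal:
  assumes cx: "simplicial_complex \<Delta>" and d: "complex_dim \<Delta> \<ge> 1" and E: "E_chordal \<Delta>"
  shows "ridge_chordal \<Delta>"
proof -
  define n where "n = nat (complex_dim \<Delta> + 1)"
  \<comment> \<open>Dimension at least 1 gives \<open>n \<ge> 2\<close>, so ridges have dimension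
    \<open>n - 2 \<ge> 0\<close> and are nonempty.\<close>
  have n: "n \<ge> 2" "complex_dim \<Delta> = int n - 1"
    using d unfolding n_def by auto
  have top: "\<forall>G\<in>\<Delta>. card G \<le> n"
    using complex_dim_le_iff[OF cx, of "complex_dim \<Delta>"] n(2) unfolding face_dim_def by auto
  obtain l where l: "inj_on l (vertices \<Delta>)" "E_labeling \<Delta> l"
    using E E_chordal_iff[OF cx] by blast
  have "int n - 1 - 1 = int n - 2"
    by simp
  with E_labeling_ridge_reduction[OF cx l top n(1) cx] show ?thesis
    unfolding ridge_chordal_def face_chordal_def n(2) using n(1) by auto
qed

subsection \<open>Strictness\<close>

lemma simplicial_complex_Union_Pow:
  assumes "finite \<F>" "\<forall>F\<in>\<F>. finite F"
  shows "simplicial_complex (\<Union>(Pow ` \<F>))"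
  unfolding simplicial_complex_def using assms by (auto intro: finite_subset)

lemma facets_Union_Pow:
  assumes "\<forall>F\<in>\<F>. \<forall>G\<in>\<F>. F \<subseteq> G \<longrightarrow> F = G"
  shows "facets (\<Union>(Pow ` \<F>)) = \<F>"
proof (intro equalityI subsetI)
  fix H assume H: "H \<in> facets (\<Union>(Pow ` \<F>))"
  then obtain G where "G \<in> \<F>" "H \<subseteq> G"
    using facet_is_face by fastforce
  with facet_maximal[OF H, of G] show "H \<in> \<F>"
    by auto
next
  fix H assume H: "H \<in> \<F>"
  have "G = H" if "G \<subseteq> G'" "G' \<in> \<F>" "H \<subseteq> G" for G G'
  proof -
    have "H = G'"
      using assms H that by (meson subset_trans)
    with that show ?thesis
      by blast
  qed
  with H show "H \<in> facets (\<Union>(Pow ` \<F>))"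
    unfolding facets_def by auto
qed

lemma complex_dim_eqI:
  assumes "simplicial_complex \<Gamma>" "F \<in> \<Gamma>" "face_dim F = j" "-1 \<le> j" "\<forall>G\<in>\<Gamma>. face_dim G \<le> j"
  shows "complex_dim \<Gamma> = j"
proof (rule antisym)
  show "complex_dim \<Gamma> \<le> j"
    using complex_dim_le_iff[OF assms(1)] assms(4,5) by blast
  show "j \<le> complex_dim \<Gamma>"
    using complex_dim_le_iff[OF assms(1), of "complex_dim \<Gamma>"] assms(2,3) by auto
qed

text \<open>The filled triangle raises the dimension, and with it the clique parameter, to 2; the
  other three edges bound a hollow triangle glued on at the vertex 3.\<close>

definition \<F>\<^sub>1 :: "nat set set" where "\<F>\<^sub>1 = {{1,2,3}, {3,4}, {4,5}, {3,5}}"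

definition \<F>\<^sub>2 :: "nat set set" where "\<F>\<^sub>2 = {{1,2,3}, {4,5}, {5,6}, {6,7}, {4,7}}"

lemma witness_complexes:
  "simplicial_complex (\<Union>(Pow ` \<F>\<^sub>1))" "facets (\<Union>(Pow ` \<F>\<^sub>1)) = \<F>\<^sub>1"
  "complex_dim (\<Union>(Pow ` \<F>\<^sub>1)) = 2"
  "simplicial_complex (\<Union>(Pow ` \<F>\<^sub>2))" "facets (\<Union>(Pow ` \<F>\<^sub>2)) = \<F>\<^sub>2"
  "complex_dim (\<Union>(Pow ` \<F>\<^sub>2)) = 2"
proof -
  show cx: "simplicial_complex (\<Union>(Pow ` \<F>\<^sub>1))" "simplicial_complex (\<Union>(Pow ` \<F>\<^sub>2))"
    by (rule simplicial_complex_Union_Pow; simp add: \<F>\<^sub>1_def \<F>\<^sub>2_def)+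
  show "facets (\<Union>(Pow ` \<F>\<^sub>1)) = \<F>\<^sub>1" "facets (\<Union>(Pow ` \<F>\<^sub>2)) = \<F>\<^sub>2"
    by (rule facets_Union_Pow; simp add: \<F>\<^sub>1_def \<F>\<^sub>2_def)+
  have dim: "complex_dim (\<Union>(Pow ` \<F>)) = 2"
    if "simplicial_complex (\<Union>(Pow ` \<F>))" "{1,2,3} \<in> \<F>" "\<forall>F\<in>\<F>. finite F \<and> card F \<le> 3" for \<F> :: "nat set set"
  proof (rule complex_dim_eqI[OF that(1)])
    show "{1,2,3} \<in> \<Union>(Pow ` \<F>)"
      using that by blast
    show "\<forall>G\<in>\<Union>(Pow ` \<F>). face_dim G \<le> 2"
      unfolding face_dim_def using that(3) by (auto dest!: bspec dest: card_mono)
  qed (simp_all add: face_dim_def)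
  show "complex_dim (\<Union>(Pow ` \<F>\<^sub>1)) = 2" "complex_dim (\<Union>(Pow ` \<F>\<^sub>2)) = 2"
    using cx by (intro dim; simp add: \<F>\<^sub>1_def \<F>\<^sub>2_def)+
qed

text \<open>The three edges of the hollow triangle stay facets throughout. A deletion at 3, 4 or 5
  would require the face \<open>{3,4,5}\<close>, which cannot coexist with the facet
  \<open>{3,4}\<close>; any other deletion leaves them in place.\<close>

lemma not_vertex_chordal_\<F>\<^sub>1: "\<not> vertex_chordal (\<Union>(Pow ` \<F>\<^sub>1))"
proof
  assume "vertex_chordal (\<Union>(Pow ` \<F>\<^sub>1))"
  then obtain \<Gamma> where \<Gamma>: "(abdel_step 2 0)\<^sup>*\<^sup>* (\<Union>(Pow ` \<F>\<^sub>1)) \<Gamma>" "complex_dim \<Gamma> \<le> 0"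
    unfolding vertex_chordal_def face_chordal_def witness_complexes by blast
  from \<Gamma>(1) have "simplicial_complex \<Gamma> \<and> {{3,4}, {4,5}, {3,5}} \<subseteq> facets \<Gamma>"
  proof (induction rule: rtranclp_induct)
    case base
    show ?case
      using witness_complexes by (simp add: \<F>\<^sub>1_def)
  next
    case (step \<Gamma> \<Gamma>')
    then have cx: "simplicial_complex \<Gamma>" and fac: "{{3,4}, {4,5}, {3,5}} \<subseteq> facets \<Gamma>"
      by auto
    obtain F where F: "face_dim F = 0" "simplicial_face 2 \<Gamma> F" "\<Gamma>' = abdel F \<Gamma>"
      using step.hyps(2) unfolding abdel_step_def by blast
    then have "card F = 1"
      unfolding face_dim_def by simp
    then obtain v where v: "F = {v}"
      using card_1_singletonE by blast
    have faces: "{3,4} \<in> \<Gamma>" "{4,5} \<in> \<Gamma>" "{3,5} \<in> \<Gamma>"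
      using fac facet_is_face by auto
    have "v \<notin> {3,4,5}"
    proof
      assume "v \<in> {3,4,5}"
      moreover have "{3} \<in> \<Gamma>" "{4} \<in> \<Gamma>" "{5} \<in> \<Gamma>"
        using face_subset[OF cx faces(1)] face_subset[OF cx faces(2)] by simp_all
      moreover have "{4,3} \<in> \<Gamma>" "{5,4} \<in> \<Gamma>" "{5,3} \<in> \<Gamma>"
        using faces by (simp_all add: insert_commute)
      ultimately have "{3,4,5} \<subseteq> vertices (star F \<Gamma>)"
        unfolding vertices_star[OF cx] v using faces by (elim insertE) simp_all
      moreover have "face_dim {3,4,5::nat} \<le> 2"
        by (simp add: face_dim_def)
      ultimately have "{3,4,5} \<in> \<Gamma>"
        using F(2) unfolding simplicial_face_def clique_def by simp
      then have "{3,4,5} = {3,4::nat}"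
        using fac by (intro facet_maximal[of _ \<Gamma>]) auto
      then show False
        by (simp add: set_eq_iff) presburger
    qed
    then show ?case
      using fac F(3) v facets_abdel[OF cx] simplicial_complex_abdel(1)[OF cx] by auto
  qed
  then have "{3,4} \<in> \<Gamma>" and cx: "simplicial_complex \<Gamma>"
    using facet_is_face[of "{3,4}" \<Gamma>] by auto
  then have "face_dim {3,4::nat} \<le> 0"
    using \<Gamma>(2) unfolding complex_dim_le_iff[OF cx] by simp
  then show False
    by (simp add: face_dim_def)
qed

lemma E_chordal_\<F>\<^sub>1: "E_chordal (\<Union>(Pow ` \<F>\<^sub>1))"
proof -
  have "E_labeling (\<Union>(Pow ` \<F>\<^sub>1)) id"
    unfolding E_labeling_def witness_complexes
  proof (intro ballI impI allI)
    fix F G v H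
    assume FG: "F \<in> \<F>\<^sub>1" "G \<in> \<F>\<^sub>1" "v \<in> F \<inter> G"
      "F \<noteq> G \<and> card F = card G \<and> (\<forall>x\<in>F \<union> G. id x \<le> id v)" "H \<subseteq> F \<union> G \<and> card H = card F"
    \<comment> \<open>Under the identity labeling only \<open>{4,5}\<close> and \<open>{3,5}\<close>
      agree in both size and maximum. All 2-subsets of their union are edges.\<close>
    from FG(1-4) have "F \<union> G = {3,4,5} \<and> card F = 2"
      unfolding \<F>\<^sub>1_def by (elim insertE emptyE) (simp_all, auto)
    then have H: "H \<subseteq> {3,4,5}" "card H = 2"
      using FG(5) by simp_all
    have "H \<noteq> {3,4,5}"
      using H(2) by (intro notI) simp
    with H(1) have "H \<subseteq> {4,5} \<or> H \<subseteq> {3,5} \<or> H \<subseteq> {3,4}"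
      by blast
    then show "H \<in> \<Union>(Pow ` \<F>\<^sub>1)"
      unfolding \<F>\<^sub>1_def by (elim disjE) simp_all
  qed
  then show ?thesis
    using E_chordal_iff[OF witness_complexes(1)] by (meson inj_on_id)
qed

text \<open>One deletion, above the edge \<open>{1,2}\<close>, removes the only 2-dimensional
  face.\<close>

lemma ridge_chordal_\<F>\<^sub>2: "ridge_chordal (\<Union>(Pow ` \<F>\<^sub>2))"
proof -
  let ?\<Gamma> = "\<Union>(Pow ` \<F>\<^sub>2)"
  have "vertices (star {1,2} ?\<Gamma>) = {1,2,3}"
    unfolding vertices_star[OF witness_complexes(4)] unfolding \<F>\<^sub>2_def by auto
  moreover have "clique 2 ?\<Gamma> {1,2,3}"
    using cliqueI[OF witness_complexes(4), of 3 "{1,2,3}" "{1,2,3}"] unfolding \<F>\<^sub>2_def by simp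
  ultimately have "simplicial_face 2 ?\<Gamma> {1,2}"
    unfolding simplicial_face_def by (simp add: \<F>\<^sub>2_def)
  then have "abdel_step 2 1 ?\<Gamma> (abdel {1,2} ?\<Gamma>)"
    unfolding abdel_step_def by (intro exI[of _ "{1,2}"]) (simp add: face_dim_def)
  moreover have "complex_dim (abdel {1,2} ?\<Gamma>) \<le> 1"
  proof -
    have "face_dim F \<le> 1" if F: "F \<in> abdel {1,2} ?\<Gamma>" for F
    proof -
      obtain H where H: "H \<in> \<F>\<^sub>2" "\<not> {1,2} \<subseteq> H" "F \<subseteq> H"
        using F unfolding abdel_def witness_complexes by blast
      from H(1,2) have "card H \<le> 2" "finite H"
        unfolding \<F>\<^sub>2_def by auto
      with card_mono[OF _ H(3)] show ?thesis
        unfolding face_dim_def by simp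
    qed
    then show ?thesis
      unfolding complex_dim_le_iff[OF simplicial_complex_abdel(1)[OF witness_complexes(4)]] by simp
  qed
  ultimately show ?thesis
    unfolding ridge_chordal_def face_chordal_def witness_complexes by (auto intro: r_into_rtranclp)
qed

text \<open>The vertex with the largest label on the 4-cycle is the top of both its edges, so
  E-chordality would force the diagonal joining its neighbours to be a face.\<close>

lemma not_E_chordal_\<F>\<^sub>2: "\<not> E_chordal (\<Union>(Pow ` \<F>\<^sub>2))"
proof
  assume "E_chordal (\<Union>(Pow ` \<F>\<^sub>2))"
  then obtain l where l: "E_labeling (\<Union>(Pow ` \<F>\<^sub>2)) l"
    using E_chordal_iff[OF witness_complexes(4)] by blast
  have not_max: "\<not> (l a \<le> l v \<and> l b \<le> l v)"
    if "{a,v} \<in> \<F>\<^sub>2" "{v,b} \<in> \<F>\<^sub>2" "a \<noteq> b" "a \<noteq> v" "v \<noteq> b" "{a,b} \<notin> \<Union>(Pow ` \<F>\<^sub>2)" for a b v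
  proof
    assume le: "l a \<le> l v \<and> l b \<le> l v"
    have "{a,b} \<in> \<Union>(Pow ` \<F>\<^sub>2)"
    proof (rule E_labelingD[OF l])
      show "{a,v} \<in> facets (\<Union>(Pow ` \<F>\<^sub>2))" "{v,b} \<in> facets (\<Union>(Pow ` \<F>\<^sub>2))"
        unfolding witness_complexes using that by simp_all
      show "{a,v} \<noteq> {v,b}" "card {a,v} = card {v,b}" "card {a,b} = card {a,v}"
        using that(3-5) by (simp_all add: doubleton_eq_iff)
      show "l x \<le> l v" if "x \<in> {a,v} \<union> {v,b}" for x
        using that le by auto
    qed auto
    with that(6) show False
      by blast
  qed
  have "\<not> (l 7 \<le> l 4 \<and> l 5 \<le> l 4)" "\<not> (l 4 \<le> l 5 \<and> l 6 \<le> l 5)"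
    "\<not> (l 5 \<le> l 6 \<and> l 7 \<le> l 6)" "\<not> (l 6 \<le> l 7 \<and> l 4 \<le> l 7)"
    by (rule not_max; simp add: \<F>\<^sub>2_def doubleton_eq_iff)+
  then show False
    by linarith
qed

text \<open>The witnesses to strictness live over \<open>nat\<close>, since an arbitrary type
  \<open>'a\<close> may have too few elements to carry them.\<close>

theorem theorem88:
  "(\<forall>\<Delta> :: 'a set set. simplicial_complex \<Delta> \<and> complex_dim \<Delta> \<ge> 1 \<longrightarrow>
      (vertex_chordal \<Delta> \<longrightarrow> E_chordal \<Delta>) \<and> (E_chordal \<Delta> \<longrightarrow> ridge_chordal \<Delta>)) \<and>
   (\<exists>\<Delta> :: nat set set. simplicial_complex \<Delta> \<and> complex_dim \<Delta> \<ge> 1 \<and>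
      E_chordal \<Delta> \<and> \<not> vertex_chordal \<Delta>) \<and>
   (\<exists>\<Delta> :: nat set set. simplicial_complex \<Delta> \<and> complex_dim \<Delta> \<ge> 1 \<and>
      ridge_chordal \<Delta> \<and> \<not> E_chordal \<Delta>) \<and>
   (\<forall>\<Delta> :: 'a set set. simplicial_complex \<Delta> \<and> complex_dim \<Delta> \<ge> 1 \<and> pure_complex \<Delta> \<longrightarrow>
      (vertex_chordal \<Delta> \<longleftrightarrow> E_chordal \<Delta>))"
proof (intro conjI)
  show "\<exists>\<Delta> :: nat set set. simplicial_complex \<Delta> \<and> complex_dim \<Delta> \<ge> 1 \<and>
      E_chordal \<Delta> \<and> \<not> vertex_chordal \<Delta>"
    using witness_complexes E_chordal_\<F>\<^sub>1 not_vertex_chordal_\<F>\<^sub>1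
    by (intro exI[of _ "\<Union>(Pow ` \<F>\<^sub>1)"]) simp
  show "\<exists>\<Delta> :: nat set set. simplicial_complex \<Delta> \<and> complex_dim \<Delta> \<ge> 1 \<and>
      ridge_chordal \<Delta> \<and> \<not> E_chordal \<Delta>"
    using witness_complexes ridge_chordal_\<F>\<^sub>2 not_E_chordal_\<F>\<^sub>2
    by (intro exI[of _ "\<Union>(Pow ` \<F>\<^sub>2)"]) simp
qed (use vertex_chordal_imp_E_chordal E_chordal_imp_ridge_chordal pure_E_chordal_imp_vertex_chordal
     in blast)+

end
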